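(* Let $1<\alpha_2<2$, let $T>0$, let $y_0,s\in\mathbb{R}$, and let $f:[0,T]\times\mathbb{R}\times\mathbb{R}\to\mathbb{R}$ satisfy a Lipschitz condition in its second and third arguments, i.e. there is a constant $L>0$ such that $$|f(t,x_1,y_1)-f(t,x_2,y_2)|\le L\left(|x_2-x_1|+|y_2-y_1|\right)$$ for all $t\in[0,T]$ and all $x_1,x_2,y_1,y_2\in\mathbb{R}$. Suppose that for every sufficiently small $\epsilon>0$ (in particular $\epsilon<1$), $(\hat y,w,z)=(\hat y_\epsilon,w_\epsilon,z_\epsilon)$ is a solution on $[0,T]$ of the system $$\begin{cases} D_0^{1-\epsilon}\hat y(t)=w(t), & \hat y(0)=y_0,\\ D_0^{\epsilon}w(t)=z(t), & w(0)=0,\\ D_0^{\alpha_2-1}z(t)=f(t,\hat y(t),w(t)), & z(0)=s,\end{cases}$$ and $(\tilde y,\tilde z)=(\tilde y_\epsilon,\tilde z_\epsilon)$ is a solution on $[0,T]$ of the system $$\begin{cases} D_0^{1-\epsilon}\tilde y(t)=\tilde z(t), & \tilde y(0)=y_0,\\ D_0^{\alpha_2-1}\tilde z(t)=f(t,\tilde y(t),\tilde z(t)), & \tilde z(0)=s.\end{cases}$$ Then for every $t\in[0,T]$, $$|\hat y_\epsilon(t)-\tilde y_\epsilon(t)|\to 0\quad\text{as }\epsilon\to 0^+.$$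
   Context: For $\alpha>0$, the Riemann-Liouville fractional integral operator of order $\alpha$ on an interval $[a,b]$ is $J_a^{\alpha}y(t)=\frac{1}{\Gamma(\alpha)}\int_a^t(t-\tau)^{\alpha-1}y(\tau)\,d\tau$ for $a\le t\le b$, and $J_a^0$ is the identity. For $\alpha>0$, the Caputo fractional derivative of order $\alpha$ is $D_a^{\alpha}y(t)=J_a^{\lceil\alpha\rceil-\alpha}y^{(\lceil\alpha\rceil)}(t)$; in particular, for $0<\alpha<1$, $D_a^{\alpha}y(t)=\frac{1}{\Gamma(1-\alpha)}\int_a^t(t-\tau)^{-\alpha}y'(\tau)\,d\tau$. Here $a=0$ and $b=T$. Solutions are continuous functions on $[0,T]$, and an initial value problem $D_0^{\beta}u(t)=g(t)$, $u(0)=u_0$ with $0<\beta<1$ is identified with the equivalent Volterra integral equation $u(t)=u_0+J_0^{\beta}g(t)$, $t\in[0,T]$. *)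

theory Defs
  imports "HOL-Analysis.Analysis"
begin

text \<open>The integral is the Lebesgue integral. The kernel has the value 0 at \<open>\<tau> = t\<close>
  (as \<open>0 powr x = 0\<close>), which is a null set.\<close>

definition riemann_liouville :: "real \<Rightarrow> real \<Rightarrow> (real \<Rightarrow> real) \<Rightarrow> real \<Rightarrow> real" where
  "riemann_liouville a \<alpha> y t =
     (if \<alpha> = 0 then y t
      else 1 / Gamma \<alpha> * (LINT \<tau>:{a..t}|lebesgue. (t - \<tau>) powr (\<alpha> - 1) * y \<tau>))"

text \<open>A solution on \<open>[a, b]\<close> of the initial value problem \<open>D\<^sub>a\<^sup>\<beta> u = g\<close>, \<open>u(a) = u\<^sub>0\<close> for the
  Caputo derivative of order \<open>0 < \<beta> < 1\<close> is a continuous function satisfying the equivalent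
  Volterra equation \<open>u = u\<^sub>0 + J\<^sub>a\<^sup>\<beta> g\<close>; this includes that the integrals occurring in it exist.
  (Without this, a non-integrable integrand would silently have integral 0.)\<close>

definition caputo_ivp_solution ::
    "real \<Rightarrow> real \<Rightarrow> real \<Rightarrow> (real \<Rightarrow> real) \<Rightarrow> real \<Rightarrow> (real \<Rightarrow> real) \<Rightarrow> bool" where
  "caputo_ivp_solution a b \<beta> g u0 u \<longleftrightarrow>
     continuous_on {a..b} u \<and>
     (\<forall>t\<in>{a..b}.
        set_integrable lebesgue {a..t} (\<lambda>\<tau>. (t - \<tau>) powr (\<beta> - 1) * g \<tau>) \<and>
        u t = u0 + riemann_liouville a \<beta> g t)"

end

theory Submission
  imports Defs
begin

text \<open>Put \<open>\<gamma> = \<alpha>\<^sub>2 - 1\<close>, \<open>R = w - z = J\<^sup>\<epsilon> z - z\<close>, \<open>V = z - ztil\<close> and \<open>E = yhat - ytil\<close>. Then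
  \<open>E = J\<^sup>1\<^sup>-\<^sup>\<epsilon> (R + V)\<close> and \<open>\<bar>V\<bar> \<le> L J\<^sup>\<gamma> (\<bar>E\<bar> + \<bar>R\<bar> + \<bar>V\<bar>)\<close>. In the norm
  \<open>sup \<bar>u t\<bar> exp (- \<mu> t)\<close> the operator \<open>J\<^sup>\<beta>\<close> has norm at most \<open>\<mu> powr - \<beta>\<close>, so for large \<open>\<mu>\<close>
  the terms in \<open>V\<close> are absorbed and \<open>E\<close> is controlled by \<open>J\<^sup>\<gamma> \<bar>R\<bar>\<close> and \<open>J\<^sup>1\<^sup>-\<^sup>\<epsilon> \<bar>R\<bar>\<close>.

  Since \<open>w 0 = 0\<close> but \<open>z 0 = s\<close>, \<open>R\<close> does not tend to 0 uniformly; it is bounded, and it tends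
  to 0 uniformly off an initial layer \<open>[0, \<delta>]\<close> because \<open>J\<^sup>\<epsilon>\<close> approximates the identity on bounded
  equicontinuous families. That the \<open>z\<^sub>\<epsilon>\<close> form such a family is seen by comparison with one fixed
  solution \<open>(Y, Z)\<close> of the second system: \<open>f\<close> need not be bounded or continuous in \<open>t\<close>, but
  \<open>z\<^sub>\<epsilon> - Z = J\<^sup>\<gamma> h\<^sub>\<epsilon>\<close> with \<open>h\<^sub>\<epsilon>\<close> bounded uniformly in \<open>\<epsilon>\<close>, hence Hoelder continuous.\<close>

section \<open>The power kernel and its integrals\<close>

text \<open>After scaling to \<open>x + y = 1\<close> this is \<open>u \<le> u powr p\<close> on the
  unit interval. It serves to bound the kernel mass of an initial layer independently of
  \<open>t\<close>.\<close>

lemma powr_add_le: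
  fixes x y p :: real
  assumes "0 \<le> x" "0 \<le> y" "0 < p" "p \<le> 1"
  shows "(x + y) powr p \<le> x powr p + y powr p"
proof (cases "x + y = 0")
  case True
  then show ?thesis using assms by simp
next
  case False
  then have s: "0 < x + y" using assms by simp
  have le: "u \<le> u powr p" if "0 \<le> u" "u \<le> 1" for u :: real
    using powr_mono'[of p 1 u] that assms by (cases "u = 0") auto
  have "1 = x / (x + y) + y / (x + y)"
    using False by (simp flip: add_divide_distrib)
  also have "\<dots> \<le> (x / (x + y)) powr p + (y / (x + y)) powr p"
    using s assms by (intro add_mono le) (auto simp: divide_simps)
  also have "\<dots> = (x powr p + y powr p) / (x + y) powr p"
    using s assms by (simp add: powr_divide add_divide_distrib)
  finally show ?thesis
    using s by (simp add: pos_le_divide_eq)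
qed

lemma Gamma_real_add1: "0 < \<beta> \<Longrightarrow> Gamma (\<beta> + 1) = \<beta> * Gamma (\<beta>::real)"
  by (rule Gamma_plus1) (auto elim!: nonpos_Ints_cases)

text \<open>The primitive is continuous up to \<open>\<tau> = t\<close> but differentiable only
  before it. The interior form of the fundamental theorem therefore admits the singular endpoint
  \<open>b = t\<close>.\<close>

lemma has_integral_powr_kernel:
  fixes \<beta> a b t :: real
  assumes "0 < \<beta>" "a \<le> b" "b \<le> t"
  shows "((\<lambda>\<tau>. (t - \<tau>) powr (\<beta> - 1)) has_integral ((t - a) powr \<beta> - (t - b) powr \<beta>) / \<beta>) {a..b}"
proof -
  have "((\<lambda>\<tau>. (t - \<tau>) powr (\<beta> - 1)) has_integral
      - ((t - b) powr \<beta>) / \<beta> - (- ((t - a) powr \<beta>) / \<beta>)) {a..b}"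
  proof (rule fundamental_theorem_of_calculus_interior[OF assms(2)])
    show "continuous_on {a..b} (\<lambda>\<tau>. - ((t - \<tau>) powr \<beta>) / \<beta>)"
      using assms by (intro continuous_intros continuous_on_powr') auto
  next
    fix x assume "x \<in> {a<..<b}"
    then have "0 < t - x" using assms by auto
    then show "((\<lambda>\<tau>. - ((t - \<tau>) powr \<beta>) / \<beta>) has_vector_derivative (t - x) powr (\<beta> - 1)) (at x)"
      using assms unfolding has_real_derivative_iff_has_vector_derivative[symmetric]
      by (auto intro!: derivative_eq_intros simp: powr_diff)
  qed
  then show ?thesis by (simp add: diff_divide_distrib)
qed

text \<open>Substituting \<open>r = \<mu> * (t - \<tau>)\<close> gives an incomplete Gamma integral
  with scaling factor \<open>1 / \<mu> powr \<beta>\<close>; since its integrand is nonnegative, the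
  complete Gamma integral bounds it.\<close>

lemma has_integral_exp_kernel:
  fixes \<beta> \<mu> t :: real
  assumes "0 < \<beta>" "0 < \<mu>" "0 \<le> t"
  obtains I where "((\<lambda>\<tau>. (t - \<tau>) powr (\<beta> - 1) * exp (\<mu> * \<tau>)) has_integral I) {0..t}"
    and "I \<le> Gamma \<beta> * exp (\<mu> * t) / \<mu> powr \<beta>"
proof -
  define h where "h = (\<lambda>r::real. r powr (\<beta> - 1) / exp r)"
  have G: "(h has_integral Gamma \<beta>) {0..}"
    unfolding h_def by (rule Gamma_integral_real[OF assms(1)])
  have hint: "h integrable_on {0..\<mu> * t}"
    by (rule integrable_on_subinterval[of h "{0..}"]) (use G in auto)
  define i where "i = integral {0..\<mu> * t} h"
  have i_le: "i \<le> Gamma \<beta>"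
    unfolding i_def integral_unique[OF G, symmetric]
    by (rule integral_subset_le) (use hint G in \<open>auto simp: h_def\<close>)
  have "(h has_integral i) (cbox 0 (\<mu> * t))"
    using hint by (auto simp: i_def)
  from has_integral_affinity[OF this, of "-\<mu>" "\<mu> * t"] assms
  have "((\<lambda>\<tau>. h (\<mu> * (t - \<tau>))) has_integral i / \<mu>) ((\<lambda>x. (- 1 / \<mu>) * x + t) ` {0..\<mu> * t})"
    by (simp add: algebra_simps)
  also have "(\<lambda>x. (- 1 / \<mu>) * x + t) ` {0..\<mu> * t} = {0..t}"
    using assms by (subst image_affinity_atLeastAtMost) (auto simp: divide_simps)
  finally have "((\<lambda>\<tau>. (exp (\<mu> * t) / \<mu> powr (\<beta> - 1)) * h (\<mu> * (t - \<tau>))) has_integral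
      (exp (\<mu> * t) / \<mu> powr (\<beta> - 1)) * (i / \<mu>)) {0..t}"
    by (rule has_integral_mult_right)
  moreover have "(exp (\<mu> * t) / \<mu> powr (\<beta> - 1)) * h (\<mu> * (t - \<tau>)) =
      (t - \<tau>) powr (\<beta> - 1) * exp (\<mu> * \<tau>)" if "\<tau> \<in> {0..t}" for \<tau>
  proof -
    have "exp (\<mu> * t) / exp (\<mu> * (t - \<tau>)) = exp (\<mu> * \<tau>)"
      by (simp add: algebra_simps flip: exp_diff)
    moreover have "(exp (\<mu> * t) / \<mu> powr (\<beta> - 1)) * h (\<mu> * (t - \<tau>)) =
        (t - \<tau>) powr (\<beta> - 1) * (exp (\<mu> * t) / exp (\<mu> * (t - \<tau>)))"
      using that assms by (simp add: h_def powr_mult)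
    ultimately show ?thesis by simp
  qed
  ultimately have "((\<lambda>\<tau>. (t - \<tau>) powr (\<beta> - 1) * exp (\<mu> * \<tau>)) has_integral
      (exp (\<mu> * t) / \<mu> powr (\<beta> - 1)) * (i / \<mu>)) {0..t}"
    by (rule has_integral_eq[rotated])
  moreover have "(exp (\<mu> * t) / \<mu> powr (\<beta> - 1)) * (i / \<mu>) = i * exp (\<mu> * t) / \<mu> powr \<beta>"
    using assms by (simp add: powr_diff)
  moreover have "\<dots> \<le> Gamma \<beta> * exp (\<mu> * t) / \<mu> powr \<beta>"
    using i_le by (intro divide_right_mono mult_right_mono) auto
  ultimately show ?thesis using that by metis
qed

section \<open>Linearity, majorants and regularity of the Riemann-Liouville integral\<close>

text \<open>Passage from the Lebesgue integral of the definition to the gauge integral, for which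
  the kernel integrals above are stated.\<close>

lemma riemann_liouville_eq_integral:
  assumes "0 < \<beta>" "set_integrable lebesgue {a..t} (\<lambda>\<tau>. (t - \<tau>) powr (\<beta> - 1) * g \<tau>)"
  shows "riemann_liouville a \<beta> g t = integral {a..t} (\<lambda>\<tau>. (t - \<tau>) powr (\<beta> - 1) * g \<tau>) / Gamma \<beta>"
  using assms set_lebesgue_integral_eq_integral(2)[OF assms(2)]
  by (simp add: riemann_liouville_def)

lemma riemann_liouville_const:
  assumes "0 < \<beta>" "a \<le> t"
  shows "set_integrable lebesgue {a..t} (\<lambda>\<tau>. (t - \<tau>) powr (\<beta> - 1) * c)"
    and "riemann_liouville a \<beta> (\<lambda>_. c) t = c * (t - a) powr \<beta> / Gamma (\<beta> + 1)"
proof -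
  have k: "((\<lambda>\<tau>. (t - \<tau>) powr (\<beta> - 1)) has_integral (t - a) powr \<beta> / \<beta>) {a..t}"
    using has_integral_powr_kernel[of \<beta> a t t] assms by simp
  have "set_integrable lebesgue {a..t} (\<lambda>\<tau>. (t - \<tau>) powr (\<beta> - 1))"
    by (rule nonnegative_absolutely_integrable_1) (use k in auto)
  then show i: "set_integrable lebesgue {a..t} (\<lambda>\<tau>. (t - \<tau>) powr (\<beta> - 1) * c)"
    by (rule set_integrable_mult_left)
  have "integral {a..t} (\<lambda>\<tau>. (t - \<tau>) powr (\<beta> - 1) * c) = (t - a) powr \<beta> / \<beta> * c"
    by (rule integral_unique[OF has_integral_mult_left[OF k]])
  then show "riemann_liouville a \<beta> (\<lambda>_. c) t = c * (t - a) powr \<beta> / Gamma (\<beta> + 1)"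
    using assms by (simp add: riemann_liouville_eq_integral[OF assms(1) i] Gamma_real_add1)
qed

lemma riemann_liouville_diff:
  assumes "0 < \<beta>"
    and "set_integrable lebesgue {a..t} (\<lambda>\<tau>. (t - \<tau>) powr (\<beta> - 1) * g \<tau>)"
    and "set_integrable lebesgue {a..t} (\<lambda>\<tau>. (t - \<tau>) powr (\<beta> - 1) * h \<tau>)"
  shows "set_integrable lebesgue {a..t} (\<lambda>\<tau>. (t - \<tau>) powr (\<beta> - 1) * (g \<tau> - h \<tau>))"
    and "riemann_liouville a \<beta> (\<lambda>\<tau>. g \<tau> - h \<tau>) t =
      riemann_liouville a \<beta> g t - riemann_liouville a \<beta> h t"
proof -
  show i: "set_integrable lebesgue {a..t} (\<lambda>\<tau>. (t - \<tau>) powr (\<beta> - 1) * (g \<tau> - h \<tau>))"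
    using set_integral_diff(1)[OF assms(2,3)] by (simp add: right_diff_distrib)
  show "riemann_liouville a \<beta> (\<lambda>\<tau>. g \<tau> - h \<tau>) t =
      riemann_liouville a \<beta> g t - riemann_liouville a \<beta> h t"
    using assms set_integral_diff(2)[OF assms(2,3)]
    by (simp add: riemann_liouville_def right_diff_distrib)
qed

lemma riemann_liouville_abs_le:
  assumes "0 < \<beta>"
    and g: "set_integrable lebesgue {a..t} (\<lambda>\<tau>. (t - \<tau>) powr (\<beta> - 1) * g \<tau>)"
    and G: "((\<lambda>\<tau>. (t - \<tau>) powr (\<beta> - 1) * G \<tau>) has_integral I) {a..t}"
    and le: "\<And>\<tau>. \<tau> \<in> {a..t} \<Longrightarrow> \<bar>g \<tau>\<bar> \<le> G \<tau>"
  shows "\<bar>riemann_liouville a \<beta> g t\<bar> \<le> I / Gamma \<beta>"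
proof -
  have "norm (integral {a..t} (\<lambda>\<tau>. (t - \<tau>) powr (\<beta> - 1) * g \<tau>))
      \<le> integral {a..t} (\<lambda>\<tau>. (t - \<tau>) powr (\<beta> - 1) * G \<tau>)"
    by (rule integral_norm_bound_integral)
      (use G le set_lebesgue_integral_eq_integral(1)[OF g] in
        \<open>auto simp: abs_mult intro!: mult_left_mono\<close>)
  with G show ?thesis
    using assms(1) Gamma_real_pos[OF assms(1)]
    by (simp add: riemann_liouville_eq_integral[OF assms(1) g] integral_unique divide_right_mono)
qed

text \<open>The constant, the bump on the initial layer and the exponential are integrated
  separately. The layer has kernel mass at most \<open>\<delta> powr \<beta> / \<beta>\<close>
  wherever \<open>t\<close> lies, by subadditivity of the power. The bump is there for the error
  \<open>w - z\<close>, which is small only off a layer.\<close>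

lemma riemann_liouville_layer_exp_bound:
  fixes \<beta> t \<mu> \<delta> :: real
  assumes "0 < \<beta>" "\<beta> \<le> 1" "0 \<le> t" "0 < \<mu>" "0 < \<delta>" "0 \<le> M" "0 \<le> N"
    and g: "set_integrable lebesgue {0..t} (\<lambda>\<tau>. (t - \<tau>) powr (\<beta> - 1) * g \<tau>)"
    and le: "\<And>\<tau>. \<tau> \<in> {0..t} \<Longrightarrow> \<bar>g \<tau>\<bar> \<le> C + M * indicator {0..\<delta>} \<tau> + N * exp (\<mu> * \<tau>)"
  shows "\<bar>riemann_liouville 0 \<beta> g t\<bar>
    \<le> (C * t powr \<beta> + M * \<delta> powr \<beta>) / Gamma (\<beta> + 1) + N * exp (\<mu> * t) / \<mu> powr \<beta>"
proof -
  let ?k = "\<lambda>\<tau>. (t - \<tau>) powr (\<beta> - 1)"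
  obtain I where I: "((\<lambda>\<tau>. ?k \<tau> * exp (\<mu> * \<tau>)) has_integral I) {0..t}"
    and I_le: "I \<le> Gamma \<beta> * exp (\<mu> * t) / \<mu> powr \<beta>"
    using has_integral_exp_kernel assms by blast
  have k: "(?k has_integral t powr \<beta> / \<beta>) {0..t}"
    using has_integral_powr_kernel[of \<beta> 0 t t] assms by simp
  \<comment> \<open>The layer may reach beyond \<open>t\<close>, so it is cut off there.\<close>
  define d where "d = min \<delta> t"
  have d: "0 \<le> d" "d \<le> t" "d \<le> \<delta>" using assms by (auto simp: d_def)
  define J where "J = (t powr \<beta> - (t - d) powr \<beta>) / \<beta>"
  have "(?k has_integral J) {0..d}"
    using has_integral_powr_kernel[of \<beta> 0 d t] assms d by (simp add: J_def)
  then have "((\<lambda>\<tau>. if \<tau> \<in> {0..d} then ?k \<tau> else 0) has_integral J) {0..t}"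
    by (subst has_integral_restrict) (use d in auto)
  then have J: "((\<lambda>\<tau>. ?k \<tau> * indicator {0..\<delta>} \<tau>) has_integral J) {0..t}"
    by (rule has_integral_eq[rotated]) (auto simp: indicator_def d_def)
  have "t powr \<beta> \<le> (t - d) powr \<beta> + d powr \<beta>"
    using powr_add_le[of "t - d" d \<beta>] d assms by simp
  moreover have "d powr \<beta> \<le> \<delta> powr \<beta>" using d assms by (intro powr_mono2) auto
  ultimately have J_le: "J \<le> \<delta> powr \<beta> / \<beta>"
    using assms unfolding J_def by (intro divide_right_mono) auto
  have "((\<lambda>\<tau>. ?k \<tau> * C + M * (?k \<tau> * indicator {0..\<delta>} \<tau>) + N * (?k \<tau> * exp (\<mu> * \<tau>)))
      has_integral (t powr \<beta> / \<beta> * C + M * J + N * I)) {0..t}"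
    by (intro has_integral_add has_integral_mult_left has_integral_mult_right k J I)
  then have "((\<lambda>\<tau>. ?k \<tau> * (C + M * indicator {0..\<delta>} \<tau> + N * exp (\<mu> * \<tau>)))
      has_integral (t powr \<beta> / \<beta> * C + M * J + N * I)) {0..t}"
    by (simp add: algebra_simps)
  from riemann_liouville_abs_le[OF assms(1) g this le]
  have "\<bar>riemann_liouville 0 \<beta> g t\<bar> \<le> (t powr \<beta> / \<beta> * C + M * J + N * I) / Gamma \<beta>" by simp
  also have "\<dots> \<le> (t powr \<beta> / \<beta> * C + M * (\<delta> powr \<beta> / \<beta>) + N * (Gamma \<beta> * exp (\<mu> * t) / \<mu> powr \<beta>)) / Gamma \<beta>"
    using Gamma_real_pos[OF assms(1)] I_le J_le assms
    by (intro divide_right_mono add_mono mult_left_mono) auto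
  also have "\<dots> = (C * t powr \<beta> + M * \<delta> powr \<beta>) / Gamma (\<beta> + 1) + N * exp (\<mu> * t) / \<mu> powr \<beta>"
  proof -
    have "(x / \<beta> * C + M * (y / \<beta>) + N * (c * e / m)) / c = (C * x + M * y) / (\<beta> * c) + N * e / m"
      if "c \<noteq> 0" "m \<noteq> 0" for x y c e m :: real
      using that assms(1) by (simp add: field_simps)
    then show ?thesis
      unfolding Gamma_real_add1[OF assms(1)]
      using Gamma_real_pos[OF assms(1)] assms(4) by (simp del: Gamma_real_pos)
  qed
  finally show ?thesis .
qed

corollary riemann_liouville_exp_bound:
  fixes \<beta> t \<mu> :: real
  assumes "0 < \<beta>" "\<beta> \<le> 1" "0 \<le> t" "0 < \<mu>" "0 \<le> N"
    and "set_integrable lebesgue {0..t} (\<lambda>\<tau>. (t - \<tau>) powr (\<beta> - 1) * g \<tau>)"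
    and "\<And>\<tau>. \<tau> \<in> {0..t} \<Longrightarrow> \<bar>g \<tau>\<bar> \<le> N * exp (\<mu> * \<tau>)"
  shows "\<bar>riemann_liouville 0 \<beta> g t\<bar> \<le> N * exp (\<mu> * t) / \<mu> powr \<beta>"
  \<comment> \<open>Layer height and constant part are 0; the layer width 1 is arbitrary.\<close>
  using riemann_liouville_layer_exp_bound[of \<beta> t \<mu> 1 0 N g 0] assms by simp

text \<open>The integral up to \<open>t\<close> is split at \<open>u\<close>. The piece over
  \<open>{u..t}\<close> has kernel mass \<open>(t - u) powr \<beta> / \<beta>\<close>. On
  \<open>{a..u}\<close> the difference of the two kernels has constant sign because
  \<open>\<beta> \<le> 1\<close>, so its mass can be computed exactly and obeys the same
  bound.\<close>

lemma riemann_liouville_Hoelder: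
  fixes \<beta> t u H :: real
  assumes "0 < \<beta>" "\<beta> \<le> 1" "a \<le> u" "u \<le> t"
    and iu: "set_integrable lebesgue {a..u} (\<lambda>\<tau>. (u - \<tau>) powr (\<beta> - 1) * h \<tau>)"
    and it: "set_integrable lebesgue {a..t} (\<lambda>\<tau>. (t - \<tau>) powr (\<beta> - 1) * h \<tau>)"
    and H: "\<And>\<tau>. \<tau> \<in> {a..t} \<Longrightarrow> \<bar>h \<tau>\<bar> \<le> H"
  shows "\<bar>riemann_liouville a \<beta> h t - riemann_liouville a \<beta> h u\<bar>
    \<le> 2 * H * (t - u) powr \<beta> / Gamma (\<beta> + 1)"
proof -
  let ?kt = "\<lambda>\<tau>. (t - \<tau>) powr (\<beta> - 1)" and ?ku = "\<lambda>\<tau>. (u - \<tau>) powr (\<beta> - 1)"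
  have H0: "0 \<le> H" using order_trans[OF abs_ge_zero H[of a]] assms by auto
  note it' = set_lebesgue_integral_eq_integral(1)[OF it]
  note iu' = set_lebesgue_integral_eq_integral(1)[OF iu]
  have itu: "(\<lambda>\<tau>. ?kt \<tau> * h \<tau>) integrable_on {a..u}"
    and itu2: "(\<lambda>\<tau>. ?kt \<tau> * h \<tau>) integrable_on {u..t}"
    by (rule integrable_on_subinterval[OF it']; use assms in auto)+
  have split: "integral {a..t} (\<lambda>\<tau>. ?kt \<tau> * h \<tau>) - integral {a..u} (\<lambda>\<tau>. ?ku \<tau> * h \<tau>)
      = integral {u..t} (\<lambda>\<tau>. ?kt \<tau> * h \<tau>) + integral {a..u} (\<lambda>\<tau>. ?kt \<tau> * h \<tau> - ?ku \<tau> * h \<tau>)"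
    using Henstock_Kurzweil_Integration.integral_combine[OF assms(3,4) it'] integral_diff[OF itu iu'] by simp
  have k1: "((\<lambda>\<tau>. ?kt \<tau> * H) has_integral (t - u) powr \<beta> / \<beta> * H) {u..t}"
    using has_integral_mult_left[OF has_integral_powr_kernel[of \<beta> u t t], of H] assms by simp
  have "norm (integral {u..t} (\<lambda>\<tau>. ?kt \<tau> * h \<tau>)) \<le> integral {u..t} (\<lambda>\<tau>. ?kt \<tau> * H)"
    by (rule integral_norm_bound_integral)
      (use k1 itu2 H assms in \<open>auto simp: abs_mult intro!: mult_left_mono\<close>)
  then have 1: "\<bar>integral {u..t} (\<lambda>\<tau>. ?kt \<tau> * h \<tau>)\<bar> \<le> (t - u) powr \<beta> / \<beta> * H"
    unfolding integral_unique[OF k1] by simp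
  let ?D = "((u - a) powr \<beta> / \<beta> - ((t - a) powr \<beta> - (t - u) powr \<beta>) / \<beta>) * H"
  have "((\<lambda>\<tau>. (?ku \<tau> - ?kt \<tau>) * H) has_integral ?D) {a..u}"
    using has_integral_powr_kernel[of \<beta> a u u] has_integral_powr_kernel[of \<beta> a u t] assms
    by (intro has_integral_mult_left has_integral_diff) auto
  \<comment> \<open>At \<open>\<tau> = u\<close> the convention \<open>0 powr x = 0\<close> makes
    \<open>?ku u\<close> vanish, so the kernels are no longer ordered there. The majorant is changed
    at this single point.\<close>
  then have k2: "((\<lambda>\<tau>. if \<tau> = u then ?kt u * H else (?ku \<tau> - ?kt \<tau>) * H) has_integral ?D) {a..u}"
    by (rule has_integral_spike_finite[where S="{u}", rotated 2]) auto
  have "norm (integral {a..u} (\<lambda>\<tau>. ?kt \<tau> * h \<tau> - ?ku \<tau> * h \<tau>))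
      \<le> integral {a..u} (\<lambda>\<tau>. if \<tau> = u then ?kt u * H else (?ku \<tau> - ?kt \<tau>) * H)"
  proof (rule integral_norm_bound_integral)
    fix \<tau> assume \<tau>: "\<tau> \<in> {a..u}"
    then have h: "\<bar>h \<tau>\<bar> \<le> H" using H assms by auto
    have le: "?kt \<tau> \<le> ?ku \<tau>" if "\<tau> \<noteq> u"
      using \<tau> that assms by (intro powr_mono2') auto
    then have "\<bar>?kt \<tau> * h \<tau> - ?ku \<tau> * h \<tau>\<bar> = (?ku \<tau> - ?kt \<tau>) * \<bar>h \<tau>\<bar>" if "\<tau> \<noteq> u"
      using le that by (simp add: abs_mult flip: left_diff_distrib)
    then show "norm (?kt \<tau> * h \<tau> - ?ku \<tau> * h \<tau>)
        \<le> (if \<tau> = u then ?kt u * H else (?ku \<tau> - ?kt \<tau>) * H)"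
      using h le by (auto simp: abs_mult intro!: mult_left_mono)
  qed (use k2 itu iu' in \<open>auto intro: integrable_diff\<close>)
  then have "\<bar>integral {a..u} (\<lambda>\<tau>. ?kt \<tau> * h \<tau> - ?ku \<tau> * h \<tau>)\<bar> \<le> ?D"
    unfolding integral_unique[OF k2] by simp
  \<comment> \<open>The rest of \<open>?D\<close>, a multiple of
    \<open>(u - a) powr \<beta> - (t - a) powr \<beta>\<close>, is not positive.\<close>
  also have "\<dots> \<le> (t - u) powr \<beta> / \<beta> * H"
    using H0 assms powr_mono2[of \<beta> "u - a" "t - a"]
    by (intro mult_right_mono) (auto simp: divide_simps)
  finally have 2: "\<bar>integral {a..u} (\<lambda>\<tau>. ?kt \<tau> * h \<tau> - ?ku \<tau> * h \<tau>)\<bar> \<le> (t - u) powr \<beta> / \<beta> * H" .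
  have "\<bar>riemann_liouville a \<beta> h t - riemann_liouville a \<beta> h u\<bar> =
      \<bar>integral {u..t} (\<lambda>\<tau>. ?kt \<tau> * h \<tau>) + integral {a..u} (\<lambda>\<tau>. ?kt \<tau> * h \<tau> - ?ku \<tau> * h \<tau>)\<bar> / Gamma \<beta>"
    using Gamma_real_pos[OF assms(1)] split
    by (simp add: riemann_liouville_eq_integral[OF assms(1) iu] riemann_liouville_eq_integral[OF assms(1) it]
        flip: diff_divide_distrib)
  also have "\<dots> \<le> (2 * ((t - u) powr \<beta> / \<beta> * H)) / Gamma \<beta>"
    using 1 2 Gamma_real_pos[OF assms(1)] by (intro divide_right_mono) auto
  also have "\<dots> = 2 * H * (t - u) powr \<beta> / Gamma (\<beta> + 1)"
    using assms by (simp add: Gamma_real_add1)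
  finally show ?thesis .
qed


text \<open>\<open>g\<close> is compared with the constant \<open>g t\<close>: the deviation is at
  most \<open>\<eta>\<close> within distance \<open>\<delta>\<close> of \<open>t\<close> and at most
  \<open>2 * M\<close> elsewhere, where the kernel mass is
  \<open>(t powr \<beta> - \<delta> powr \<beta>) / \<beta>\<close>. The last term accounts for the
  integral of the constant 1 not being exactly 1. For fixed positive \<open>t\<close> and
  \<open>\<delta>\<close>, everything but the part with \<open>\<eta>\<close> vanishes as
  \<open>\<beta>\<close> tends to 0, at a rate depending on \<open>g\<close> only through
  \<open>M\<close>.\<close>

lemma riemann_liouville_near_identity:
  fixes \<beta> t \<delta> :: real
  assumes "0 < \<beta>" "0 \<le> t" "0 \<le> \<delta>" "\<delta> \<le> t" "0 \<le> \<eta>"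
    and g: "set_integrable lebesgue {0..t} (\<lambda>\<tau>. (t - \<tau>) powr (\<beta> - 1) * g \<tau>)"
    and near: "\<And>\<tau>. \<tau> \<in> {0..t} \<Longrightarrow> t - \<tau> \<le> \<delta> \<Longrightarrow> \<bar>g \<tau> - g t\<bar> \<le> \<eta>"
    and M: "\<And>\<tau>. \<tau> \<in> {0..t} \<Longrightarrow> \<bar>g \<tau>\<bar> \<le> M"
  shows "\<bar>riemann_liouville 0 \<beta> g t - g t\<bar> \<le>
    (\<eta> * t powr \<beta> + 2 * M * (t powr \<beta> - \<delta> powr \<beta>)) / Gamma (\<beta> + 1) +
    M * \<bar>t powr \<beta> / Gamma (\<beta> + 1) - 1\<bar>"
proof -
  let ?k = "\<lambda>\<tau>. (t - \<tau>) powr (\<beta> - 1)"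
  note c = riemann_liouville_const[OF assms(1,2), of "g t"]
  note d = riemann_liouville_diff[OF assms(1) g c(1)]
  have k: "(?k has_integral t powr \<beta> / \<beta>) {0..t}"
    using has_integral_powr_kernel[of \<beta> 0 t t] assms by simp
  have "(?k has_integral (t powr \<beta> - \<delta> powr \<beta>) / \<beta>) {0..t - \<delta>}"
    using has_integral_powr_kernel[of \<beta> 0 "t - \<delta>" t] assms by simp
  then have "((\<lambda>\<tau>. if \<tau> \<in> {0..t - \<delta>} then ?k \<tau> else 0)
      has_integral (t powr \<beta> - \<delta> powr \<beta>) / \<beta>) {0..t}"
    by (subst has_integral_restrict) (use assms in auto)
  then have "((\<lambda>\<tau>. ?k \<tau> * \<eta> + (if \<tau> \<in> {0..t - \<delta>} then ?k \<tau> else 0) * (2 * M)) has_integral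
      t powr \<beta> / \<beta> * \<eta> + (t powr \<beta> - \<delta> powr \<beta>) / \<beta> * (2 * M)) {0..t}"
    by (intro has_integral_add has_integral_mult_left k)
  then have I: "((\<lambda>\<tau>. ?k \<tau> * (\<eta> + (if \<tau> \<in> {0..t - \<delta>} then 2 * M else 0))) has_integral
      t powr \<beta> / \<beta> * \<eta> + (t powr \<beta> - \<delta> powr \<beta>) / \<beta> * (2 * M)) {0..t}"
    by (rule has_integral_eq[rotated]) (auto simp: algebra_simps)
  have "\<bar>g \<tau> - g t\<bar> \<le> \<eta> + (if \<tau> \<in> {0..t - \<delta>} then 2 * M else 0)" if "\<tau> \<in> {0..t}" for \<tau>
    using that near[OF that] M[OF that] M[of t] assms(2,5) by (auto simp: abs_le_iff)
  from riemann_liouville_abs_le[OF assms(1) d(1) I this]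
  have "\<bar>riemann_liouville 0 \<beta> g t - g t * (t powr \<beta> / Gamma (\<beta> + 1))\<bar> \<le>
      (t powr \<beta> / \<beta> * \<eta> + (t powr \<beta> - \<delta> powr \<beta>) / \<beta> * (2 * M)) / Gamma \<beta>"
    by (simp add: d(2) c(2))
  also have "\<dots> = (\<eta> * t powr \<beta> + 2 * M * (t powr \<beta> - \<delta> powr \<beta>)) / Gamma (\<beta> + 1)"
    using assms(1) unfolding Gamma_real_add1[OF assms(1)]
    by (simp add: add_divide_distrib diff_divide_distrib algebra_simps)
  finally have 1: "\<bar>riemann_liouville 0 \<beta> g t - g t * (t powr \<beta> / Gamma (\<beta> + 1))\<bar> \<le> \<dots>" .
  have "\<bar>g t * (t powr \<beta> / Gamma (\<beta> + 1)) - g t\<bar> = \<bar>g t\<bar> * \<bar>t powr \<beta> / Gamma (\<beta> + 1) - 1\<bar>"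
    by (simp add: right_diff_distrib flip: abs_mult)
  also have "\<dots> \<le> M * \<bar>t powr \<beta> / Gamma (\<beta> + 1) - 1\<bar>"
    using M[of t] assms(2) by (intro mult_right_mono) auto
  finally show ?thesis using 1 by linarith
qed

section \<open>Volterra solutions in the exponentially weighted norm\<close>

text \<open>\<open>N\<close> is the weighted norm of \<open>u\<close>. As it is attained, an
  estimate of \<open>u\<close> at the single point \<open>t\<close> becomes an inequality for
  \<open>N\<close> itself, which can then be solved for \<open>N\<close>.\<close>

lemma weighted_sup_attained:
  fixes u :: "real \<Rightarrow> real"
  assumes "a \<le> b" "continuous_on {a..b} u"
  obtains N t where "0 \<le> N" "t \<in> {a..b}" "N * exp (\<mu> * t) = \<bar>u t\<bar>"
    "\<And>\<tau>. \<tau> \<in> {a..b} \<Longrightarrow> \<bar>u \<tau>\<bar> \<le> N * exp (\<mu> * \<tau>)"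
proof -
  have "continuous_on {a..b} (\<lambda>\<tau>. \<bar>u \<tau>\<bar> / exp (\<mu> * \<tau>))"
    using assms(2) by (intro continuous_intros) auto
  then obtain t where t: "t \<in> {a..b}"
    and le: "\<And>\<tau>. \<tau> \<in> {a..b} \<Longrightarrow> \<bar>u \<tau>\<bar> / exp (\<mu> * \<tau>) \<le> \<bar>u t\<bar> / exp (\<mu> * t)"
    using continuous_attains_sup[OF compact_Icc, of a b "\<lambda>\<tau>. \<bar>u \<tau>\<bar> / exp (\<mu> * \<tau>)"] assms(1)
    by auto
  show ?thesis
    by (rule that[of "\<bar>u t\<bar> / exp (\<mu> * t)" t]) (use t le in \<open>auto simp: pos_divide_le_eq\<close>)
qed

lemma caputo_ivp_solutionD:
  assumes "caputo_ivp_solution a b \<beta> g u0 u"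
  shows "continuous_on {a..b} u"
    and "t \<in> {a..b} \<Longrightarrow> set_integrable lebesgue {a..t} (\<lambda>\<tau>. (t - \<tau>) powr (\<beta> - 1) * g \<tau>)"
    and "t \<in> {a..b} \<Longrightarrow> u t = u0 + riemann_liouville a \<beta> g t"
  using assms by (auto simp: caputo_ivp_solution_def)

lemma caputo_ivp_solution_diff:
  assumes "0 < \<beta>" "caputo_ivp_solution a b \<beta> g u0 u" "caputo_ivp_solution a b \<beta> h v0 v"
  shows "caputo_ivp_solution a b \<beta> (\<lambda>t. g t - h t) (u0 - v0) (\<lambda>t. u t - v t)"
  unfolding caputo_ivp_solution_def
proof (intro conjI ballI)
  show "continuous_on {a..b} (\<lambda>t. u t - v t)"
    using assms(2,3)[THEN caputo_ivp_solutionD(1)] by (intro continuous_intros)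
next
  fix t assume t: "t \<in> {a..b}"
  note g = caputo_ivp_solutionD(2,3)[OF assms(2) t] and h = caputo_ivp_solutionD(2,3)[OF assms(3) t]
  note d = riemann_liouville_diff[OF assms(1) g(1) h(1)]
  show "set_integrable lebesgue {a..t} (\<lambda>\<tau>. (t - \<tau>) powr (\<beta> - 1) * (g \<tau> - h \<tau>))"
    by (fact d(1))
  show "u t - v t = u0 - v0 + riemann_liouville a \<beta> (\<lambda>\<tau>. g \<tau> - h \<tau>) t"
    using g(2) h(2) d(2) by simp
qed

text \<open>The integral gains the factor \<open>1 / \<mu> powr \<beta>\<close>, and the initial
  value fits under the weight because \<open>exp (\<mu> * t)\<close> is at least 1.\<close>

lemma caputo_ivp_solution_exp_bound:
  assumes sol: "caputo_ivp_solution 0 T \<beta> g u0 u"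
    and "0 < \<beta>" "\<beta> \<le> 1" "1 \<le> \<mu>" "0 \<le> N"
    and "\<And>\<tau>. \<tau> \<in> {0..T} \<Longrightarrow> \<bar>g \<tau>\<bar> \<le> N * exp (\<mu> * \<tau>)" "t \<in> {0..T}"
  shows "\<bar>u t\<bar> \<le> (\<bar>u0\<bar> + N / \<mu> powr \<beta>) * exp (\<mu> * t)"
proof -
  have "\<bar>riemann_liouville 0 \<beta> g t\<bar> \<le> N * exp (\<mu> * t) / \<mu> powr \<beta>"
    by (rule riemann_liouville_exp_bound) (use assms caputo_ivp_solutionD(2)[OF sol] in auto)
  moreover have "\<bar>u0\<bar> \<le> \<bar>u0\<bar> * exp (\<mu> * t)"
    using assms by (simp add: mult_le_cancel_left1)
  ultimately show ?thesis
    using caputo_ivp_solutionD(3)[OF sol assms(7)] by (simp add: distrib_right)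
qed

text \<open>Used for the orders \<open>\<epsilon>\<close> and \<open>1 - \<epsilon>\<close>, where a
  bound uniform in \<open>\<epsilon>\<close> suffices; \<open>\<mu> powr \<epsilon>\<close> tends to
  1, so order \<open>\<epsilon>\<close> offers no uniform gain. The contraction comes from order
  \<open>\<gamma>\<close>.\<close>

lemma divide_powr_le:
  fixes x \<mu> p :: real
  assumes "0 \<le> x" "1 \<le> \<mu>" "0 \<le> p"
  shows "x / \<mu> powr p \<le> x"
  using assms by (simp add: divide_le_eq mult_le_cancel_left1 ge_one_powr_ge_zero)

section \<open>Estimates for the two systems, uniform in the small order\<close>

text \<open>Let \<open>N\<close> be the weighted norm of \<open>z\<close>. Then \<open>w\<close> has
  norm at most \<open>N\<close> and \<open>y\<close> at most \<open>A + N\<close>. Subtracting the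
  equation of \<open>Z\<close> leaves only differences of \<open>f\<close>, to which the Lipschitz
  condition applies. With \<open>4 * L \<le> \<mu> powr \<gamma>\<close> this yields
  \<open>N \<le> A + (2 * N + 3 * A) / 4\<close>, which bounds \<open>N\<close> by a multiple of
  \<open>A\<close> free of \<open>\<epsilon>\<close>.\<close>

lemma hat_system_bounds:
  fixes f :: "real \<Rightarrow> real \<Rightarrow> real \<Rightarrow> real"
  assumes "0 < \<epsilon>" "\<epsilon> < 1" "0 < \<gamma>" "\<gamma> \<le> 1" "0 \<le> T" "0 \<le> L"
    and lip: "\<And>t x1 x2 y1 y2. t \<in> {0..T} \<Longrightarrow>
           \<bar>f t x1 y1 - f t x2 y2\<bar> \<le> L * (\<bar>x2 - x1\<bar> + \<bar>y2 - y1\<bar>)"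
    and y: "caputo_ivp_solution 0 T (1 - \<epsilon>) w y0 y"
    and w: "caputo_ivp_solution 0 T \<epsilon> z 0 w"
    and z: "caputo_ivp_solution 0 T \<gamma> (\<lambda>t. f t (y t) (w t)) s z"
    and Z: "caputo_ivp_solution 0 T \<gamma> (\<lambda>t. f t (Y t) (Z t)) s Z"
    and A: "\<bar>y0\<bar> \<le> A" "\<And>t. t \<in> {0..T} \<Longrightarrow> \<bar>Y t\<bar> \<le> A" "\<And>t. t \<in> {0..T} \<Longrightarrow> \<bar>Z t\<bar> \<le> A"
    and \<mu>: "1 \<le> \<mu>" "4 * L \<le> \<mu> powr \<gamma>"
    and t: "t \<in> {0..T}"
  shows "\<bar>z t\<bar> \<le> 4 * A * exp (\<mu> * T)"
    and "\<bar>f t (y t) (w t) - f t (Y t) (Z t)\<bar> \<le> 11 * L * A * exp (\<mu> * T)"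
proof -
  obtain N t0 where N: "0 \<le> N" "t0 \<in> {0..T}" "N * exp (\<mu> * t0) = \<bar>z t0\<bar>"
    and z_le: "\<And>\<tau>. \<tau> \<in> {0..T} \<Longrightarrow> \<bar>z \<tau>\<bar> \<le> N * exp (\<mu> * \<tau>)"
    using weighted_sup_attained[OF assms(5) caputo_ivp_solutionD(1)[OF z], of \<mu>] by metis
  have A0: "0 \<le> A" using A(1) by simp
  have e1: "1 \<le> exp (\<mu> * \<tau>)" if "\<tau> \<in> {0..T}" for \<tau>
    using that \<mu>(1) by simp
  have div_le: "N / \<mu> powr p \<le> N" if "0 < p" for p
    using N(1) that \<mu>(1) by (intro divide_powr_le) auto
  have w_le: "\<bar>w \<tau>\<bar> \<le> N * exp (\<mu> * \<tau>)" if "\<tau> \<in> {0..T}" for \<tau>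
  proof -
    have "\<bar>w \<tau>\<bar> \<le> (\<bar>0\<bar> + N / \<mu> powr \<epsilon>) * exp (\<mu> * \<tau>)"
      by (rule caputo_ivp_solution_exp_bound[OF w]) (use assms N z_le that in auto)
    also have "\<dots> \<le> N * exp (\<mu> * \<tau>)"
      using div_le[of \<epsilon>] assms by (intro mult_right_mono) auto
    finally show ?thesis .
  qed
  have y_le: "\<bar>y \<tau>\<bar> \<le> (A + N) * exp (\<mu> * \<tau>)" if "\<tau> \<in> {0..T}" for \<tau>
  proof -
    have "\<bar>y \<tau>\<bar> \<le> (\<bar>y0\<bar> + N / \<mu> powr (1 - \<epsilon>)) * exp (\<mu> * \<tau>)"
      by (rule caputo_ivp_solution_exp_bound[OF y]) (use assms N w_le that in auto)
    also have "\<dots> \<le> (A + N) * exp (\<mu> * \<tau>)"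
      using div_le[of "1 - \<epsilon>"] assms by (intro mult_right_mono add_mono) auto
    finally show ?thesis .
  qed
  have f_le: "\<bar>f \<tau> (y \<tau>) (w \<tau>) - f \<tau> (Y \<tau>) (Z \<tau>)\<bar> \<le> L * (2 * N + 3 * A) * exp (\<mu> * \<tau>)"
    if \<tau>: "\<tau> \<in> {0..T}" for \<tau>
  proof -
    have "\<bar>Y \<tau> - y \<tau>\<bar> + \<bar>Z \<tau> - w \<tau>\<bar> \<le> A + (A + N) * exp (\<mu> * \<tau>) + (A + N * exp (\<mu> * \<tau>))"
      using y_le[OF \<tau>] w_le[OF \<tau>] A(2,3)[OF \<tau>] by linarith
    also have "\<dots> \<le> (2 * N + 3 * A) * exp (\<mu> * \<tau>)"
      using mult_left_mono[OF e1[OF \<tau>] A0] by (simp add: algebra_simps)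
    finally have "L * (\<bar>Y \<tau> - y \<tau>\<bar> + \<bar>Z \<tau> - w \<tau>\<bar>) \<le> L * ((2 * N + 3 * A) * exp (\<mu> * \<tau>))"
      using assms(6) by (rule mult_left_mono)
    with lip[OF \<tau>, of "y \<tau>" "w \<tau>" "Y \<tau>" "Z \<tau>"] show ?thesis by simp
  qed
  have "\<bar>z t0 - Z t0\<bar> \<le> (\<bar>s - s\<bar> + L * (2 * N + 3 * A) / \<mu> powr \<gamma>) * exp (\<mu> * t0)"
    by (rule caputo_ivp_solution_exp_bound[OF caputo_ivp_solution_diff[OF assms(3) z Z]])
      (use assms N A0 f_le in auto)
  also have "\<dots> \<le> (2 * N + 3 * A) / 4 * exp (\<mu> * t0)"
  proof (rule mult_right_mono)
    have "4 * L * (2 * N + 3 * A) \<le> \<mu> powr \<gamma> * (2 * N + 3 * A)"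
      using N(1) A0 \<mu>(2) by (intro mult_right_mono) auto
    then show "\<bar>s - s\<bar> + L * (2 * N + 3 * A) / \<mu> powr \<gamma> \<le> (2 * N + 3 * A) / 4"
      using \<mu>(1) by (simp add: divide_le_eq mult.commute)
  qed simp
  finally have "N * exp (\<mu> * t0) \<le> A + (2 * N + 3 * A) / 4 * exp (\<mu> * t0)"
    using N(3) A(3)[OF N(2)] by linarith
  also have "\<dots> \<le> (A + (2 * N + 3 * A) / 4) * exp (\<mu> * t0)"
    using mult_left_mono[OF e1[OF N(2)] A0] by (simp add: algebra_simps)
  finally have "N \<le> A + (2 * N + 3 * A) / 4"
    by simp
  then have N_le: "N \<le> 4 * A"
    using A0 by (simp add: field_simps)
  have e: "exp (\<mu> * t) \<le> exp (\<mu> * T)"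
    using t \<mu>(1) by simp
  show "\<bar>z t\<bar> \<le> 4 * A * exp (\<mu> * T)"
    using z_le[OF t] mult_mono[OF N_le e] A0 by simp
  \<comment> \<open>The 11 is \<open>2 * 4 + 3\<close>, from \<open>N \<le> 4 * A\<close>.\<close>
  have "L * (2 * N + 3 * A) * exp (\<mu> * t) \<le> L * (11 * A) * exp (\<mu> * T)"
    using N_le e A0 assms(6) N(1) by (intro mult_mono mult_left_mono) auto
  with f_le[OF t] show "\<bar>f t (y t) (w t) - f t (Y t) (Z t)\<bar> \<le> 11 * L * A * exp (\<mu> * T)"
    by (simp add: mult_ac)
qed

text \<open>Let \<open>N\<close> be the weighted norm of \<open>z - z'\<close>. Since
  \<open>w - z'\<close> is \<open>w - z\<close> plus \<open>z - z'\<close>, the difference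
  \<open>y - y'\<close> has norm at most \<open>\<rho> + N\<close>. The equations of
  \<open>z\<close> and \<open>z'\<close> then give
  \<open>N \<le> L * \<rho> + (\<rho> + 2 * N) / 4\<close>, and solving for \<open>N\<close> gives
  the constant \<open>2 * L + 3 / 2\<close>.\<close>

lemma system_difference_bound:
  fixes f :: "real \<Rightarrow> real \<Rightarrow> real \<Rightarrow> real"
  assumes "0 < \<epsilon>" "\<epsilon> < 1" "0 < \<gamma>" "\<gamma> \<le> 1" "0 \<le> T" "0 \<le> L"
    and lip: "\<And>t x1 x2 y1 y2. t \<in> {0..T} \<Longrightarrow>
           \<bar>f t x1 y1 - f t x2 y2\<bar> \<le> L * (\<bar>x2 - x1\<bar> + \<bar>y2 - y1\<bar>)"
    and y: "caputo_ivp_solution 0 T (1 - \<epsilon>) w y0 y"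
    and z: "caputo_ivp_solution 0 T \<gamma> (\<lambda>t. f t (y t) (w t)) s z"
    and y': "caputo_ivp_solution 0 T (1 - \<epsilon>) z' y0 y'"
    and z': "caputo_ivp_solution 0 T \<gamma> (\<lambda>t. f t (y' t) (z' t)) s z'"
    and \<mu>: "1 \<le> \<mu>" "4 * L \<le> \<mu> powr \<gamma>"
    and R: "\<And>t. t \<in> {0..T} \<Longrightarrow> \<bar>w t - z t\<bar> \<le> \<eta> + M * indicator {0..\<delta>} t"
    and "0 < \<delta>" "0 \<le> M" "0 \<le> \<eta>"
    and \<rho>: "(\<eta> * T powr \<gamma> + M * \<delta> powr \<gamma>) / Gamma (\<gamma> + 1) \<le> \<rho>"
      "(\<eta> * T powr (1 - \<epsilon>) + M * \<delta> powr (1 - \<epsilon>)) / Gamma (1 - \<epsilon> + 1) \<le> \<rho>"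
    and t: "t \<in> {0..T}"
  shows "\<bar>y t - y' t\<bar> \<le> (2 * L + 3 / 2) * exp (\<mu> * T) * \<rho>"
proof -
  note dz = caputo_ivp_solution_diff[OF assms(3) z z']
  have "0 < 1 - \<epsilon>" using assms by simp
  note dy = caputo_ivp_solution_diff[OF this y y']
  obtain N t0 where N: "0 \<le> N" "t0 \<in> {0..T}" "N * exp (\<mu> * t0) = \<bar>z t0 - z' t0\<bar>"
    and v_le: "\<And>\<tau>. \<tau> \<in> {0..T} \<Longrightarrow> \<bar>z \<tau> - z' \<tau>\<bar> \<le> N * exp (\<mu> * \<tau>)"
    using weighted_sup_attained[OF assms(5) caputo_ivp_solutionD(1)[OF dz], of \<mu>] by metis
  have "0 \<le> (\<eta> * T powr \<gamma> + M * \<delta> powr \<gamma>) / Gamma (\<gamma> + 1)"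
    using assms by (intro divide_nonneg_nonneg add_nonneg_nonneg mult_nonneg_nonneg
        less_imp_le[OF Gamma_real_pos]) auto
  with \<rho>(1) have \<rho>0: "0 \<le> \<rho>" by linarith
  have e1: "1 \<le> exp (\<mu> * \<tau>)" if "\<tau> \<in> {0..T}" for \<tau>
    using that \<mu>(1) by simp
  have layer_le: "(\<eta> * \<tau> powr p + M * \<delta> powr p) / Gamma (p + 1) \<le> \<rho>"
    if "(\<eta> * T powr p + M * \<delta> powr p) / Gamma (p + 1) \<le> \<rho>" "0 < p" "\<tau> \<in> {0..T}" for p \<tau>
  proof -
    have "(\<eta> * \<tau> powr p + M * \<delta> powr p) / Gamma (p + 1) \<le>
        (\<eta> * T powr p + M * \<delta> powr p) / Gamma (p + 1)"
      using that assms by (intro divide_right_mono add_mono mult_left_mono powr_mono2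
          less_imp_le[OF Gamma_real_pos]) auto
    with that(1) show ?thesis by linarith
  qed
  have d_le: "\<bar>w \<tau> - z' \<tau>\<bar> \<le> \<eta> + M * indicator {0..\<delta>} \<tau> + N * exp (\<mu> * \<tau>)"
    if "\<tau> \<in> {0..T}" for \<tau>
    using R[OF that] v_le[OF that] by linarith
  have y_le: "\<bar>y \<tau> - y' \<tau>\<bar> \<le> (\<rho> + N) * exp (\<mu> * \<tau>)" if \<tau>: "\<tau> \<in> {0..T}" for \<tau>
  proof -
    have "\<bar>riemann_liouville 0 (1 - \<epsilon>) (\<lambda>t. w t - z' t) \<tau>\<bar>
        \<le> (\<eta> * \<tau> powr (1 - \<epsilon>) + M * \<delta> powr (1 - \<epsilon>)) / Gamma (1 - \<epsilon> + 1) +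
          N * exp (\<mu> * \<tau>) / \<mu> powr (1 - \<epsilon>)"
      by (rule riemann_liouville_layer_exp_bound)
        (use assms \<tau> N d_le caputo_ivp_solutionD(2)[OF dy] in auto)
    also have "\<dots> \<le> \<rho> + N * exp (\<mu> * \<tau>)"
      by (rule add_mono[OF layer_le[OF \<rho>(2)] divide_powr_le])
        (use assms(1,2) \<mu>(1) N(1) \<tau> in auto)
    also have "\<dots> \<le> (\<rho> + N) * exp (\<mu> * \<tau>)"
      using mult_left_mono[OF e1[OF \<tau>] \<rho>0] by (simp add: distrib_right)
    finally show ?thesis
      using caputo_ivp_solutionD(3)[OF dy \<tau>] by simp
  qed
  have f_le: "\<bar>f \<tau> (y \<tau>) (w \<tau>) - f \<tau> (y' \<tau>) (z' \<tau>)\<bar> \<le>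
      L * \<eta> + L * M * indicator {0..\<delta>} \<tau> + L * (\<rho> + 2 * N) * exp (\<mu> * \<tau>)"
    if \<tau>: "\<tau> \<in> {0..T}" for \<tau>
  proof -
    have "\<bar>y' \<tau> - y \<tau>\<bar> + \<bar>z' \<tau> - w \<tau>\<bar> \<le> \<eta> + M * indicator {0..\<delta>} \<tau> + (\<rho> + 2 * N) * exp (\<mu> * \<tau>)"
      using y_le[OF \<tau>] d_le[OF \<tau>] by (simp add: abs_minus_commute algebra_simps)
    then have "L * (\<bar>y' \<tau> - y \<tau>\<bar> + \<bar>z' \<tau> - w \<tau>\<bar>) \<le>
        L * (\<eta> + M * indicator {0..\<delta>} \<tau> + (\<rho> + 2 * N) * exp (\<mu> * \<tau>))"
      using assms(6) by (rule mult_left_mono)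
    with lip[OF \<tau>, of "y \<tau>" "w \<tau>" "y' \<tau>" "z' \<tau>"] show ?thesis
      by (simp add: algebra_simps)
  qed
  have "\<bar>riemann_liouville 0 \<gamma> (\<lambda>t. f t (y t) (w t) - f t (y' t) (z' t)) t0\<bar>
      \<le> (L * \<eta> * t0 powr \<gamma> + L * M * \<delta> powr \<gamma>) / Gamma (\<gamma> + 1) +
        L * (\<rho> + 2 * N) * exp (\<mu> * t0) / \<mu> powr \<gamma>"
    by (rule riemann_liouville_layer_exp_bound)
      (use assms N \<rho>0 f_le caputo_ivp_solutionD(2)[OF dz] in auto)
  \<comment> \<open>Regrouped so that the layer part is bounded through \<open>\<rho>\<close> while
    the exponential part carries the small factor \<open>L / \<mu> powr \<gamma>\<close>.\<close>
  also have "\<dots> = L * ((\<eta> * t0 powr \<gamma> + M * \<delta> powr \<gamma>) / Gamma (\<gamma> + 1)) +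
      L / \<mu> powr \<gamma> * ((\<rho> + 2 * N) * exp (\<mu> * t0))"
    by (simp add: distrib_left mult.assoc)
  also have "\<dots> \<le> L * \<rho> + 1 / 4 * ((\<rho> + 2 * N) * exp (\<mu> * t0))"
  proof (rule add_mono[OF mult_left_mono[OF layer_le[OF \<rho>(1) assms(3) N(2)]] mult_right_mono])
    show "L / \<mu> powr \<gamma> \<le> 1 / 4"
      using \<mu> by (simp add: pos_divide_le_eq)
  qed (use assms(6) N(1) \<rho>0 in auto)
  also have "\<dots> \<le> (L * \<rho> + (\<rho> + 2 * N) / 4) * exp (\<mu> * t0)"
    using mult_left_mono[OF e1[OF N(2)], of "L * \<rho>"] \<rho>0 assms(6) by (simp add: distrib_right)
  finally have "N * exp (\<mu> * t0) \<le> \<dots>"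
    using N(3) caputo_ivp_solutionD(3)[OF dz N(2)] by simp
  then have "N \<le> L * \<rho> + (\<rho> + 2 * N) / 4"
    by simp
  then have "\<rho> + N \<le> (2 * L + 3 / 2) * \<rho>"
    by (simp add: field_simps)
  moreover have "exp (\<mu> * t) \<le> exp (\<mu> * T)"
    using t \<mu>(1) by simp
  ultimately have "(\<rho> + N) * exp (\<mu> * t) \<le> (2 * L + 3 / 2) * \<rho> * exp (\<mu> * T)"
    using assms(6) \<rho>0 by (intro mult_mono) auto
  with y_le[OF t] show ?thesis by (simp add: mult_ac)
qed

section \<open>Convergence as the small order tends to 0\<close>

theorem theorem2p1:
  fixes \<alpha>\<^sub>2 T y\<^sub>0 s L :: real
    and f :: "real \<Rightarrow> real \<Rightarrow> real \<Rightarrow> real"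
    and yhat w z ytil ztil :: "real \<Rightarrow> real \<Rightarrow> real"
  assumes "1 < \<alpha>\<^sub>2" and "\<alpha>\<^sub>2 < 2"
    and "T > 0"
    and "L > 0"
    and lipschitz: "\<And>t x1 x2 y1 y2. t \<in> {0..T} \<Longrightarrow>
           \<bar>f t x1 y1 - f t x2 y2\<bar> \<le> L * (\<bar>x2 - x1\<bar> + \<bar>y2 - y1\<bar>)"
    and hat_system: "\<forall>\<^sub>F \<epsilon> in at_right 0.
           caputo_ivp_solution 0 T (1 - \<epsilon>) (w \<epsilon>) y\<^sub>0 (yhat \<epsilon>) \<and>
           caputo_ivp_solution 0 T \<epsilon> (z \<epsilon>) 0 (w \<epsilon>) \<and>
           caputo_ivp_solution 0 T (\<alpha>\<^sub>2 - 1) (\<lambda>t. f t (yhat \<epsilon> t) (w \<epsilon> t)) s (z \<epsilon>)"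
    and tilde_system: "\<forall>\<^sub>F \<epsilon> in at_right 0.
           caputo_ivp_solution 0 T (1 - \<epsilon>) (ztil \<epsilon>) y\<^sub>0 (ytil \<epsilon>) \<and>
           caputo_ivp_solution 0 T (\<alpha>\<^sub>2 - 1) (\<lambda>t. f t (ytil \<epsilon> t) (ztil \<epsilon> t)) s (ztil \<epsilon>)"
  shows "\<forall>t\<in>{0..T}. ((\<lambda>\<epsilon>. \<bar>yhat \<epsilon> t - ytil \<epsilon> t\<bar>) \<longlongrightarrow> 0) (at_right 0)"
proof
  fix t assume t: "t \<in> {0..T}"
  define \<gamma> where "\<gamma> = \<alpha>\<^sub>2 - 1"
  have \<gamma>: "0 < \<gamma>" "\<gamma> \<le> 1" using assms(1,2) by (auto simp: \<gamma>_def)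
  have G\<gamma>: "0 < Gamma (\<gamma> + 1)" using \<gamma> by (intro Gamma_real_pos) auto
  \<comment> \<open>One member of the second family is frozen as reference pair
    \<open>(Y, Z)\<close>. The order of the equation for \<open>Z\<close> does not involve
    \<open>\<epsilon>\<close>, so it can be subtracted from that of \<open>z \<epsilon>\<close> for
    every \<open>\<epsilon>\<close>.\<close>
  obtain \<epsilon>\<^sub>0 where "caputo_ivp_solution 0 T (1 - \<epsilon>\<^sub>0) (ztil \<epsilon>\<^sub>0) y\<^sub>0 (ytil \<epsilon>\<^sub>0)"
    and "caputo_ivp_solution 0 T (\<alpha>\<^sub>2 - 1) (\<lambda>t. f t (ytil \<epsilon>\<^sub>0 t) (ztil \<epsilon>\<^sub>0 t)) s (ztil \<epsilon>\<^sub>0)"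
    using eventually_happens'[OF _ tilde_system] by auto
  then obtain Y Z where Y: "continuous_on {0..T} Y"
    and Z: "caputo_ivp_solution 0 T \<gamma> (\<lambda>t. f t (Y t) (Z t)) s Z"
    unfolding \<gamma>_def using caputo_ivp_solutionD(1) by metis
  note Zc = caputo_ivp_solutionD(1)[OF Z]
  have "bounded (Y ` {0..T} \<union> Z ` {0..T} \<union> {y\<^sub>0})"
    using Y Zc by (auto intro!: compact_imp_bounded compact_continuous_image)
  then obtain A where A: "\<bar>y\<^sub>0\<bar> \<le> A" "\<And>t. t \<in> {0..T} \<Longrightarrow> \<bar>Y t\<bar> \<le> A" "\<And>t. t \<in> {0..T} \<Longrightarrow> \<bar>Z t\<bar> \<le> A"
    by (fastforce simp: bounded_iff)
  define \<mu> where "\<mu> = max 1 ((4 * L) powr (1 / \<gamma>))"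
  have \<mu>1: "1 \<le> \<mu>" by (simp add: \<mu>_def)
  have "4 * L = ((4 * L) powr (1 / \<gamma>)) powr \<gamma>"
    using \<gamma> assms(4) by (simp add: powr_powr)
  also have "\<dots> \<le> \<mu> powr \<gamma>"
    using \<gamma> by (intro powr_mono2) (auto simp: \<mu>_def)
  finally have \<mu>2: "4 * L \<le> \<mu> powr \<gamma>" .
  define M where "M = 4 * A * exp (\<mu> * T)"
  define H where "H = 11 * L * A * exp (\<mu> * T)"
  have M0: "0 \<le> M" and H0: "0 \<le> H" using A(1) assms(4) by (auto simp: M_def H_def)

  have powr0: "((\<lambda>x. x powr \<gamma>) \<longlongrightarrow> 0) (at_right 0)"
    using \<gamma>(1) by (intro tendsto_eq_rhs[OF tendsto_powr'[OF tendsto_ident_at tendsto_const]])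
      (auto intro: eventually_at_rightI[of _ 1])
  show "((\<lambda>\<epsilon>. \<bar>yhat \<epsilon> t - ytil \<epsilon> t\<bar>) \<longlongrightarrow> 0) (at_right 0)"
  proof (rule tendstoI)
    fix \<kappa> :: real assume "0 < \<kappa>"
    \<comment> \<open>With this \<open>\<rho>\<close> the bound of
      \<open>system_difference_bound\<close> equals \<open>\<kappa> / 2\<close>.\<close>
    define \<rho> where "\<rho> = \<kappa> / (2 * ((2 * L + 3 / 2) * exp (\<mu> * T)))"
    have "0 < (2 * L + 3 / 2) * exp (\<mu> * T)" using assms(4) by simp
    then have \<rho>: "0 < \<rho>" "(2 * L + 3 / 2) * exp (\<mu> * T) * \<rho> < \<kappa>"
      using \<open>0 < \<kappa>\<close> by (auto simp: \<rho>_def)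
    \<comment> \<open>Here \<open>x\<close> stands for both the tolerance off the layer and the
      layer width; the actual width will be some \<open>\<delta> < \<eta>\<close>. The height
      \<open>3 * M\<close> comes from the bounds \<open>2 * M\<close> for \<open>w\<close> and
      \<open>M\<close> for \<open>z\<close>.\<close>
    have "((\<lambda>x. (x * T powr \<gamma> + 3 * M * x powr \<gamma>) / Gamma (\<gamma> + 1)) \<longlongrightarrow> 0) (at_right 0)"
      by (intro tendsto_divide_zero tendsto_add_zero tendsto_mult_left_zero tendsto_mult_right_zero
          tendsto_ident_at powr0)
    then have ev1: "\<forall>\<^sub>F x in at_right 0. (x * T powr \<gamma> + 3 * M * x powr \<gamma>) / Gamma (\<gamma> + 1) < \<rho>"
      using \<rho>(1) by (rule order_tendstoD)
    \<comment> \<open>The same quantity for the order \<open>1 - \<epsilon>\<close> in the limit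
      \<open>\<epsilon> = 0\<close>, where the Gamma factor is 1.\<close>
    have "((\<lambda>x. x * T + 3 * M * x) \<longlongrightarrow> 0) (at_right 0)"
      by (auto intro!: tendsto_eq_intros)
    then have ev2: "\<forall>\<^sub>F x in at_right 0. x * T + 3 * M * x < \<rho>"
      using \<rho>(1) by (rule order_tendstoD)
    obtain \<eta> where \<eta>: "0 < \<eta>" "(\<eta> * T powr \<gamma> + 3 * M * \<eta> powr \<gamma>) / Gamma (\<gamma> + 1) < \<rho>"
      "\<eta> * T + 3 * M * \<eta> < \<rho>"
      using eventually_happens'[OF _ eventually_conj[OF eventually_at_right_less[of 0]
          eventually_conj[OF ev1 ev2]]] by auto
    have "uniformly_continuous_on {0..T} Z"
      using Zc by (intro compact_uniformly_continuous) auto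
    then obtain d where d: "0 < d"
      "\<And>t u. t \<in> {0..T} \<Longrightarrow> u \<in> {0..T} \<Longrightarrow> \<bar>u - t\<bar> < d \<Longrightarrow> \<bar>Z u - Z t\<bar> < \<eta> / 4"
      using \<eta>(1) unfolding uniformly_continuous_on_def dist_real_def
      by (metis zero_less_divide_iff zero_less_numeral)
    have "((\<lambda>x. 2 * H * x powr \<gamma> / Gamma (\<gamma> + 1)) \<longlongrightarrow> 0) (at_right 0)"
      by (intro tendsto_divide_zero tendsto_add_zero tendsto_mult_left_zero tendsto_mult_right_zero
          tendsto_ident_at powr0)
    then have ev3: "\<forall>\<^sub>F x in at_right 0. 2 * H * x powr \<gamma> / Gamma (\<gamma> + 1) < \<eta> / 4"
      by (rule order_tendstoD) (use \<eta>(1) in auto)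
    have ev4: "\<forall>\<^sub>F x in at_right 0. x < min d (min \<eta> T)"
      using d(1) \<eta>(1) assms(3) by (intro order_tendstoD[OF tendsto_ident_at]) auto
    \<comment> \<open>\<open>\<delta>\<close> is both the layer width and the window of
      near-constancy of \<open>z\<close>: over distance \<open>\<delta>\<close>, \<open>Z\<close>
      and \<open>z - Z\<close> each vary by less than \<open>\<eta> / 4\<close>. It is fixed before
      \<open>\<epsilon>\<close>.\<close>
    obtain \<delta> where \<delta>: "0 < \<delta>" "\<delta> < d" "\<delta> < \<eta>" "\<delta> < T" "2 * H * \<delta> powr \<gamma> / Gamma (\<gamma> + 1) < \<eta> / 4"
      using eventually_happens'[OF _ eventually_conj[OF eventually_at_right_less[of 0]
          eventually_conj[OF ev3 ev4]]] by auto
    have \<rho>\<gamma>: "(\<eta> * T powr \<gamma> + 3 * M * \<delta> powr \<gamma>) / Gamma (\<gamma> + 1) \<le> \<rho>"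
    proof -
      have "(\<eta> * T powr \<gamma> + 3 * M * \<delta> powr \<gamma>) / Gamma (\<gamma> + 1)
          \<le> (\<eta> * T powr \<gamma> + 3 * M * \<eta> powr \<gamma>) / Gamma (\<gamma> + 1)"
        using \<delta> \<gamma> G\<gamma> M0 by (intro divide_right_mono add_mono mult_left_mono powr_mono2) auto
      with \<eta>(2) show ?thesis by linarith
    qed

    \<comment> \<open>\<open>q x \<epsilon>\<close> is the integral of order
      \<open>\<epsilon>\<close> of the constant 1 at \<open>x\<close>. It tends to 1 for each
      \<open>x > 0\<close>, but not uniformly near 0, which is why a layer is excluded.\<close>
    define q where "q = (\<lambda>x \<epsilon>::real. x powr \<epsilon> / Gamma (\<epsilon> + 1))"
    have q_lim: "((\<lambda>\<epsilon>. q x \<epsilon>) \<longlongrightarrow> 1) (at_right 0)" if "0 < x" for x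
      unfolding q_def using that by (auto intro!: tendsto_eq_intros)
    have ev5: "\<forall>\<^sub>F \<epsilon> in at_right 0. q T \<epsilon> < 2"
      by (rule order_tendstoD[OF q_lim]) (use assms(3) in auto)
    \<comment> \<open>This bounds the near-identity error at all points of
      \<open>{\<delta>..T}\<close> at once, and its limit \<open>\<eta> / 2\<close> leaves room
      below \<open>\<eta>\<close>.\<close>
    have "((\<lambda>\<epsilon>. (\<eta> / 2 * q T \<epsilon> + 2 * M * (q T \<epsilon> - q \<delta> \<epsilon>)) + M * (\<bar>q T \<epsilon> - 1\<bar> + \<bar>q \<delta> \<epsilon> - 1\<bar>)) \<longlongrightarrow> \<eta> / 2)
        (at_right 0)"
      by (rule tendsto_eq_intros q_lim \<delta>(1) assms(3) refl)+ simp
    then have ev6: "\<forall>\<^sub>F \<epsilon> in at_right 0.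
        (\<eta> / 2 * q T \<epsilon> + 2 * M * (q T \<epsilon> - q \<delta> \<epsilon>)) + M * (\<bar>q T \<epsilon> - 1\<bar> + \<bar>q \<delta> \<epsilon> - 1\<bar>) < \<eta>"
      by (rule order_tendstoD) (use \<eta>(1) in auto)
    have "((\<lambda>\<epsilon>. (\<eta> * T powr (1 - \<epsilon>) + 3 * M * \<delta> powr (1 - \<epsilon>)) / Gamma (1 - \<epsilon> + 1)) \<longlongrightarrow>
        (\<eta> * T powr (1 - 0) + 3 * M * \<delta> powr (1 - 0)) / Gamma (1 - 0 + 1)) (at_right 0)"
      using assms(3) \<delta>(1)
      by (intro tendsto_intros) (auto elim!: nonpos_Ints_cases simp: Gamma_numeral)
    moreover have "\<eta> * T + 3 * M * \<delta> < \<rho>"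
      using \<eta>(3) mult_left_mono[of \<delta> \<eta> "3 * M"] \<delta>(3) M0 by linarith
    then have "(\<eta> * T powr (1 - 0) + 3 * M * \<delta> powr (1 - 0)) / Gamma (1 - 0 + 1) < \<rho>"
      using assms(3) \<delta>(1) by (simp add: Gamma_numeral)
    ultimately have ev7: "\<forall>\<^sub>F \<epsilon> in at_right 0.
        (\<eta> * T powr (1 - \<epsilon>) + 3 * M * \<delta> powr (1 - \<epsilon>)) / Gamma (1 - \<epsilon> + 1) < \<rho>"
      by (rule order_tendstoD)
    have ev8: "\<forall>\<^sub>F \<epsilon> in at_right (0::real). \<epsilon> < 1"
      by (intro order_tendstoD[OF tendsto_ident_at]) auto
    show "\<forall>\<^sub>F \<epsilon> in at_right 0. dist \<bar>yhat \<epsilon> t - ytil \<epsilon> t\<bar> 0 < \<kappa>"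
      using hat_system tilde_system ev5 ev6 ev7 ev8 eventually_at_right_less[of 0]
    proof eventually_elim
      case (elim \<epsilon>)
      then have \<epsilon>: "0 < \<epsilon>" "\<epsilon> < 1"
        and y: "caputo_ivp_solution 0 T (1 - \<epsilon>) (w \<epsilon>) y\<^sub>0 (yhat \<epsilon>)"
        and w: "caputo_ivp_solution 0 T \<epsilon> (z \<epsilon>) 0 (w \<epsilon>)"
        and z: "caputo_ivp_solution 0 T \<gamma> (\<lambda>t. f t (yhat \<epsilon> t) (w \<epsilon> t)) s (z \<epsilon>)"
        and y': "caputo_ivp_solution 0 T (1 - \<epsilon>) (ztil \<epsilon>) y\<^sub>0 (ytil \<epsilon>)"
        and z': "caputo_ivp_solution 0 T \<gamma> (\<lambda>t. f t (ytil \<epsilon> t) (ztil \<epsilon> t)) s (ztil \<epsilon>)"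
        by (auto simp: \<gamma>_def)
      have G\<epsilon>: "0 < Gamma (\<epsilon> + 1)" using \<epsilon> by (intro Gamma_real_pos) auto
      note bounds = hat_system_bounds[OF \<epsilon> \<gamma> less_imp_le[OF assms(3)] less_imp_le[OF assms(4)]
          lipschitz y w z Z A \<mu>1 \<mu>2]
      have z_le: "\<bar>z \<epsilon> \<tau>\<bar> \<le> M" if "\<tau> \<in> {0..T}" for \<tau>
        unfolding M_def by (rule bounds(1)) (use that in auto)
      have f_le: "\<bar>f \<tau> (yhat \<epsilon> \<tau>) (w \<epsilon> \<tau>) - f \<tau> (Y \<tau>) (Z \<tau>)\<bar> \<le> H" if "\<tau> \<in> {0..T}" for \<tau>
        unfolding H_def by (rule bounds(2)) (use that in auto)
      note dz = caputo_ivp_solution_diff[OF \<gamma>(1) z Z]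
      have z_near: "\<bar>z \<epsilon> \<tau> - z \<epsilon> u\<bar> \<le> \<eta> / 2" if \<tau>: "0 \<le> \<tau>" "\<tau> \<le> u" "u \<le> T" "u - \<tau> \<le> \<delta>" for \<tau> u
      proof -
        have "\<bar>(z \<epsilon> u - Z u) - (z \<epsilon> \<tau> - Z \<tau>)\<bar> =
            \<bar>riemann_liouville 0 \<gamma> (\<lambda>t. f t (yhat \<epsilon> t) (w \<epsilon> t) - f t (Y t) (Z t)) u -
             riemann_liouville 0 \<gamma> (\<lambda>t. f t (yhat \<epsilon> t) (w \<epsilon> t) - f t (Y t) (Z t)) \<tau>\<bar>"
          using caputo_ivp_solutionD(3)[OF dz, of u] caputo_ivp_solutionD(3)[OF dz, of \<tau>] \<tau> by simp
        also have "\<dots> \<le> 2 * H * (u - \<tau>) powr \<gamma> / Gamma (\<gamma> + 1)"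
          by (rule riemann_liouville_Hoelder)
            (use \<gamma> \<tau> f_le caputo_ivp_solutionD(2)[OF dz, of u] caputo_ivp_solutionD(2)[OF dz, of \<tau>] in auto)
        also have "\<dots> \<le> 2 * H * \<delta> powr \<gamma> / Gamma (\<gamma> + 1)"
          using \<tau> \<gamma> G\<gamma> H0 by (intro divide_right_mono mult_left_mono powr_mono2) auto
        finally have "\<bar>(z \<epsilon> u - Z u) - (z \<epsilon> \<tau> - Z \<tau>)\<bar> < \<eta> / 4" using \<delta>(5) by linarith
        moreover have "\<bar>Z \<tau> - Z u\<bar> < \<eta> / 4"
          using d(2)[of u \<tau>] \<tau> \<delta>(2) by auto
        ultimately show ?thesis by linarith
      qed
      have R: "\<bar>w \<epsilon> u - z \<epsilon> u\<bar> \<le> \<eta> + 3 * M * indicator {0..\<delta>} u" if u: "u \<in> {0..T}" for u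
      proof (cases "u \<le> \<delta>")
        case True
        \<comment> \<open>Inside the layer boundedness is enough. The zero terms fill the layer and
          exponential parts of the general bound.\<close>
        have "\<bar>w \<epsilon> u\<bar> \<le> (M * u powr \<epsilon> + 0 * 1 powr \<epsilon>) / Gamma (\<epsilon> + 1) + 0 * exp (1 * u) / 1 powr \<epsilon>"
          unfolding caputo_ivp_solutionD(3)[OF w u] add_0
          by (rule riemann_liouville_layer_exp_bound)
            (use \<epsilon> u M0 z_le caputo_ivp_solutionD(2)[OF w u] in auto)
        also have "\<dots> = M * q u \<epsilon>" by (simp add: q_def)
        also have "\<dots> \<le> M * q T \<epsilon>"
          unfolding q_def using M0 u \<epsilon> G\<epsilon> by (intro mult_left_mono divide_right_mono powr_mono2) auto
        also have "\<dots> \<le> M * 2" using M0 \<open>q T \<epsilon> < 2\<close> by (intro mult_left_mono) auto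
        finally show ?thesis using z_le[OF u] u True \<eta>(1) by simp
      next
        case False
        have q: "q \<delta> \<epsilon> \<le> q u \<epsilon>" "q u \<epsilon> \<le> q T \<epsilon>"
          unfolding q_def using u \<epsilon> G\<epsilon> \<delta>(1) False by (auto intro!: divide_right_mono powr_mono2)
        have "\<bar>w \<epsilon> u - z \<epsilon> u\<bar> \<le> (\<eta> / 2 * u powr \<epsilon> + 2 * M * (u powr \<epsilon> - \<delta> powr \<epsilon>)) / Gamma (\<epsilon> + 1) +
            M * \<bar>u powr \<epsilon> / Gamma (\<epsilon> + 1) - 1\<bar>"
          unfolding caputo_ivp_solutionD(3)[OF w u] add_0
          by (rule riemann_liouville_near_identity)
            (use \<epsilon> u \<delta>(1) \<eta>(1) False z_near z_le caputo_ivp_solutionD(2)[OF w u] in auto)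
        also have "\<dots> = (\<eta> / 2 * q u \<epsilon> + 2 * M * (q u \<epsilon> - q \<delta> \<epsilon>)) + M * \<bar>q u \<epsilon> - 1\<bar>"
          by (simp add: q_def add_divide_distrib right_diff_distrib diff_divide_distrib)
        \<comment> \<open>As \<open>q u \<epsilon>\<close> lies between
          \<open>q \<delta> \<epsilon>\<close> and \<open>q T \<epsilon>\<close>, its distance to 1
          is controlled by the two endpoint distances, which removes the dependence on
          \<open>u\<close>.\<close>
        also have "\<dots> \<le> (\<eta> / 2 * q T \<epsilon> + 2 * M * (q T \<epsilon> - q \<delta> \<epsilon>)) + M * (\<bar>q T \<epsilon> - 1\<bar> + \<bar>q \<delta> \<epsilon> - 1\<bar>)"
          using q M0 \<eta>(1) by (intro add_mono mult_left_mono) auto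
        finally show ?thesis using elim False by simp
      qed
      have "\<bar>yhat \<epsilon> t - ytil \<epsilon> t\<bar> \<le> (2 * L + 3 / 2) * exp (\<mu> * T) * \<rho>"
        by (rule system_difference_bound[OF \<epsilon> \<gamma> less_imp_le[OF assms(3)] less_imp_le[OF assms(4)]
            lipschitz y z y' z' \<mu>1 \<mu>2 R \<delta>(1) _ less_imp_le[OF \<eta>(1)] \<rho>\<gamma> _ t])
          (use M0 elim in auto)
      with \<rho>(2) show ?case by simp
    qed
  qed
qed

end
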